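(* Let $b\ge1$, let $r_0,\dots,r_{b-1}$ be nonnegative row-vectors, $M_0,\dots,M_{b-1}$ nonnegative square matrices and $c$ a positive column-vector (all of the same dimension) such that $\sum_ir_ic=1$ and $\sum_iM_ic=c$, and let $\nu$ be the probability measure on $\Omega_b=\{0,\dots,b-1\}^{\mathbb N}$ defined by $\nu([\omega_1\dots\omega_n])=r_{\omega_1}M_{\omega_2}\cdots M_{\omega_n}c$ for every cylinder set. Suppose that: $\bullet$ $c_{\omega,n}=\frac{M_{\omega_1}\cdots M_{\omega_n}c}{\Vert M_{\omega_1}\cdots M_{\omega_n}c\Vert}$ converges, as $n\to\infty$, uniformly on $\omega\in\Omega_b$ to a limit $c_\omega$; $\bullet$ for all $i\in\{0,\dots,b-1\}$, $(r_ic_{\omega,n})^{1/n}$ converges to $1$, as $n\to\infty$, uniformly on $\omega\in\Omega_b$; $\bullet$ for all $\omega\in\Omega_b$ and all $i\in\{0,\dots,b-1\}$, $M_ic_\omega\ne0$. Then $\nu$ has the weak-Gibbs property.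
   Context: A matrix or vector is nonnegative (resp. positive) if all its entries are $\ge0$ (resp. $>0$). $\Vert X\Vert$ is the sum of the absolute values of the entries of $X$. $[\omega_1\dots\omega_n]:=\{\xi\in\Omega_b:\xi_1=\omega_1,\dots,\xi_n=\omega_n\}$, $\Omega_b$ carries the product topology, and $\sigma$ is the shift $\sigma((\omega_n)_n)=(\omega_{n+1})_n$. It is understood that the vectors $M_{\omega_1}\cdots M_{\omega_n}c$ are nonnull, so that $c_{\omega,n}$ is defined. A probability measure $\nu$ on $\Omega_b$ has the weak-Gibbs property if there exists a continuous map $\Phi:\Omega_b\to\mathbb R$ such that $$\lim_{n\to\infty}\Big(\frac{\nu([\omega_1\dots\omega_n])}{\exp\big(\sum_{k=0}^{n-1}\Phi(\sigma^k\omega)\big)}\Big)^{1/n}=1\quad\text{uniformly on }\omega\in\Omega_b.$$ *)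

theory Defs
  imports "HOL-Probability.Probability"
begin

text \<open>The letters \<open>0,\<dots>,b-1\<close> are natural numbers and a one-sided sequence
  \<open>(\<omega>\<^sub>1, \<omega>\<^sub>2, \<dots>)\<close> is a function \<open>\<omega>\<close> with \<open>\<omega> 0 = \<omega>\<^sub>1\<close>, \<open>\<omega> 1 = \<omega>\<^sub>2\<close>, and so on.\<close>

definition Omega :: "nat \<Rightarrow> (nat \<Rightarrow> nat) set" where
  "Omega b = {\<omega>. \<forall>n. \<omega> n < b}"

text \<open>Continuity on \<open>Omega b\<close> is taken in the type-class topology of \<open>nat \<Rightarrow> nat\<close>, which
  induces on \<open>Omega b\<close> the product of the discrete topologies.\<close>

lemma top_of_set_Omega:
  "top_of_set (Omega b) = product_topology (\<lambda>_. discrete_topology {..<b}) UNIV"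
proof -
  have "(euclidean :: nat topology) = discrete_topology UNIV"
    by (simp add: topology_eq Topological_Spaces.open_discrete)
  then have "top_of_set {..<b} = discrete_topology {..<b}"
    by simp
  moreover have "Omega b = (\<Pi>\<^sub>E i\<in>UNIV. {..<b})"
    by (auto simp: Omega_def PiE_def extensional_def)
  moreover have "top_of_set (\<Pi>\<^sub>E i\<in>(UNIV :: nat set). {..<b}) =
      product_topology (\<lambda>_. top_of_set {..<b}) UNIV"
    using subtopology_product_topology[of "\<lambda>_. euclidean" UNIV "\<lambda>_. {..<b}"]
    by (simp only: euclidean_product_topology)
  ultimately show ?thesis
    by (simp only:)
qed

definition seq_shift :: "(nat \<Rightarrow> nat) \<Rightarrow> nat \<Rightarrow> nat" where
  "seq_shift \<omega> = (\<lambda>n. \<omega> (Suc n))"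

text \<open>The cylinder \<open>[\<omega>\<^sub>1\<dots>\<omega>\<^sub>n]\<close>. If \<open>b \<ge> 1\<close>, every finite word over the alphabet is the prefix
  of some \<open>\<omega>\<close> in \<open>Omega b\<close>, so letting \<open>\<omega>\<close> range over \<open>Omega b\<close> covers all cylinders.\<close>

definition cylinder :: "nat \<Rightarrow> (nat \<Rightarrow> nat) \<Rightarrow> nat \<Rightarrow> (nat \<Rightarrow> nat) set" where
  "cylinder b \<omega> n = {\<xi> \<in> Omega b. \<forall>k<n. \<xi> k = \<omega> k}"

text \<open>The product \<open>M\<^bsub>\<omega>\<^sub>1\<^esub> \<cdots> M\<^bsub>\<omega>\<^sub>n\<^esub>\<close> (the identity for \<open>n = 0\<close>).\<close>

primrec mat_prod :: "(nat \<Rightarrow> real^'d^'d) \<Rightarrow> (nat \<Rightarrow> nat) \<Rightarrow> nat \<Rightarrow> real^'d^'d" where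
  "mat_prod M \<omega> 0 = mat 1"
| "mat_prod M \<omega> (Suc n) = mat_prod M \<omega> n ** M (\<omega> n)"

definition norm_sum :: "real^'d \<Rightarrow> real" where
  "norm_sum x = (\<Sum>j\<in>UNIV. \<bar>x $ j\<bar>)"

definition c_vec :: "(nat \<Rightarrow> real^'d^'d) \<Rightarrow> real^'d \<Rightarrow> (nat \<Rightarrow> nat) \<Rightarrow> nat \<Rightarrow> real^'d" where
  "c_vec M c \<omega> n =
     (1 / norm_sum (mat_prod M \<omega> n *v c)) *\<^sub>R (mat_prod M \<omega> n *v c)"

definition weak_Gibbs :: "nat \<Rightarrow> (nat \<Rightarrow> nat) measure \<Rightarrow> bool" where
  "weak_Gibbs b \<nu> \<longleftrightarrow>
     (\<exists>\<Phi> :: (nat \<Rightarrow> nat) \<Rightarrow> real. continuous_on (Omega b) \<Phi> \<and>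
        uniform_limit (Omega b)
          (\<lambda>n \<omega>. root n (measure \<nu> (cylinder b \<omega> n) /
                         exp (\<Sum>k<n. \<Phi> ((seq_shift ^^ k) \<omega>))))
          (\<lambda>_. 1) sequentially)"

end

theory Submission
  imports Defs
begin

text \<open>Write \<open>P\<^sub>n(\<omega>)\<close> for the entry sum of \<open>M\<^bsub>\<omega>\<^sub>1\<^esub> \<cdots> M\<^bsub>\<omega>\<^sub>n\<^esub> c\<close>. Then
  \<open>P\<^bsub>n+1\<^esub>(\<omega>) = g\<^sub>n(\<omega>) P\<^sub>n(\<sigma>\<omega>)\<close>, where \<open>g\<^sub>n(\<omega>)\<close> is the entry sum of
  \<open>M\<^bsub>\<omega>\<^sub>1\<^esub> c\<^bsub>\<sigma>\<omega>,n\<^esub>\<close>. The continuous functions \<open>g\<^sub>n\<close> converge uniformly, and by compactness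
  their limit is bounded away from 0; let \<open>\<Phi>\<close> be the logarithm of this limit.
  Then \<open>ln P\<^sub>n\<close> differs from the Birkhoff sum of \<open>\<Phi>\<close> by a bounded term plus a sum of \<open>n\<close> errors
  tending to 0 uniformly, which is \<open>o(n)\<close>. The factor \<open>r\<^sub>i c\<^bsub>\<sigma>\<omega>,n\<^esub>\<close> by which
  \<open>\<nu>([\<omega>\<^sub>1\<dots>\<omega>\<^bsub>n+1\<^esub>])\<close> differs from \<open>P\<^sub>n(\<sigma>\<omega>)\<close> is subexponential by hypothesis.\<close>

section \<open>Uniform limits\<close>

text \<open>Finitely many eventualities hold simultaneously, so the index may depend on the point.
  Below, \<open>h\<close> is usually the first letter and \<open>k\<close> the shift.\<close>

lemma uniform_limit_finite_family:
  assumes fin: "finite I"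
    and lim: "\<And>i. i \<in> I \<Longrightarrow> uniform_limit A (f i) (l i) F"
    and maps: "\<And>x. x \<in> B \<Longrightarrow> h x \<in> I" "\<And>x. x \<in> B \<Longrightarrow> k x \<in> A"
  shows "uniform_limit B (\<lambda>n x. f (h x) n (k x)) (\<lambda>x. l (h x) (k x)) F"
proof (rule uniform_limitI)
  fix e :: real assume "e > 0"
  then have "\<forall>\<^sub>F n in F. \<forall>i\<in>I. \<forall>x\<in>A. dist (f i n x) (l i x) < e"
    using fin lim by (intro eventually_ball_finite ballI uniform_limitD)
  then show "\<forall>\<^sub>F n in F. \<forall>x\<in>B. dist (f (h x) n (k x)) (l (h x) (k x)) < e"
    by eventually_elim (use maps in blast)
qed

lemma uniform_limit_of_tendsto:
  assumes "(f \<longlongrightarrow> l) F"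
  shows "uniform_limit X (\<lambda>n _. f n) (\<lambda>_. l) F"
  using assms unfolding uniform_limit_iff tendsto_iff by (blast intro: eventually_mono)

lemma uniform_limit_ln:
  fixes f :: "'i \<Rightarrow> 'a \<Rightarrow> real"
  assumes lim: "uniform_limit X f l F" and "\<delta> > 0" and low: "\<And>x. x \<in> X \<Longrightarrow> \<delta> \<le> l x"
  shows "uniform_limit X (\<lambda>n x. ln (f n x)) (\<lambda>x. ln (l x)) F"
proof (rule uniform_limitI)
  fix e :: real assume "e > 0"
  \<comment> \<open>The first bound keeps \<open>f n x\<close> above \<open>\<delta> / 2\<close>;
    the second suits the Lipschitz constant \<open>2 / \<delta>\<close> of \<open>ln\<close> on that
    range.\<close>
  define d where "d = min (\<delta> / 2) (e * (\<delta> / 2))"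
  have "d > 0" using \<open>e > 0\<close> \<open>\<delta> > 0\<close> by (simp add: d_def)
  from uniform_limitD[OF lim this]
  show "\<forall>\<^sub>F n in F. \<forall>x\<in>X. dist (ln (f n x)) (ln (l x)) < e"
  proof eventually_elim
    case (elim n)
    show ?case
    proof
      fix x assume x: "x \<in> X"
      let ?a = "f n x" and ?b = "l x"
      have d: "\<bar>?a - ?b\<bar> < \<delta> / 2" "\<bar>?a - ?b\<bar> < e * (\<delta> / 2)"
        using elim x by (auto simp: d_def dist_real_def)
      have ab: "?a \<ge> \<delta> / 2" "?b \<ge> \<delta> / 2" "?a > 0" "?b > 0"
        using d low[OF x] \<open>\<delta> > 0\<close> by linarith+
      \<comment> \<open>One-sided, so that using it in both orders bounds the absolute
        value.\<close>
      have "ln u - ln v < e" if uv: "u \<ge> \<delta> / 2" "v \<ge> \<delta> / 2" "\<bar>u - v\<bar> < e * (\<delta> / 2)" for u v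
      proof -
        have "u > 0" "v > 0" using uv \<open>\<delta> > 0\<close> by linarith+
        then have "ln u - ln v \<le> (u - v) / v" by (rule ln_diff_le)
        also have "\<dots> \<le> \<bar>u - v\<bar> / v" using \<open>v > 0\<close> by (simp add: divide_right_mono)
        also have "\<dots> < e"
        proof -
          have "e * (\<delta> / 2) \<le> e * v" using uv \<open>e > 0\<close> by (intro mult_left_mono) auto
          then show ?thesis using uv \<open>v > 0\<close> by (simp add: pos_divide_less_eq)
        qed
        finally show ?thesis .
      qed
      from this[of ?a ?b] this[of ?b ?a] show "dist (ln ?a) (ln ?b) < e"
        using ab d by (auto simp: dist_real_def abs_less_iff abs_minus_commute)
    qed
  qed
qed

lemma cesaro_mean_tendsto_zero:
  fixes E :: "nat \<Rightarrow> real"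
  assumes "E \<longlonglongrightarrow> 0"
  shows "(\<lambda>n. (\<Sum>j<n. E j) / real (Suc n)) \<longlonglongrightarrow> 0"
proof (rule LIMSEQ_I)
  fix e :: real assume "e > 0"
  then obtain N where N: "\<And>j. j \<ge> N \<Longrightarrow> \<bar>E j\<bar> < e / 2"
    using LIMSEQ_D[OF assms, of "e / 2"] by auto
  define C where "C = (\<Sum>j<N. \<bar>E j\<bar>)"
  have sum: "(\<Sum>j<n. \<bar>E j\<bar>) \<le> C + real n * (e / 2)" for n
  proof (induction n)
    case 0
    show ?case by (simp add: C_def sum_nonneg)
  next
    case (Suc n)
    show ?case
    proof (cases "n < N")
      case True
      then have "(\<Sum>j<Suc n. \<bar>E j\<bar>) \<le> C"
        unfolding C_def by (intro sum_mono2) auto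
      moreover have "0 \<le> real (Suc n) * (e / 2)" using \<open>e > 0\<close> by simp
      ultimately show ?thesis by linarith
    next
      case False
      then show ?thesis using Suc N[of n] by (simp add: field_simps)
    qed
  qed
  \<comment> \<open>For \<open>n \<ge> K\<close> the initial block \<open>C\<close> costs less than
    \<open>n * (e / 2)\<close>, which is also the bound for the remaining terms.\<close>
  obtain K where K: "C < real K * (e / 2)"
    using \<open>e > 0\<close> reals_Archimedean3[of "e / 2"] by auto
  show "\<exists>no. \<forall>n\<ge>no. norm ((\<Sum>j<n. E j) / real (Suc n) - 0) < e"
  proof (intro exI allI impI)
    fix n assume "n \<ge> K"
    then have "real K * (e / 2) \<le> real n * (e / 2)"
      using \<open>e > 0\<close> by (intro mult_right_mono) auto
    then have "\<bar>\<Sum>j<n. E j\<bar> < real n * e"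
      using K sum[of n] sum_abs[of E "{..<n}"] unfolding times_divide_eq_right by linarith
    also have "\<dots> \<le> real (Suc n) * e" using \<open>e > 0\<close> by simp
    finally show "norm ((\<Sum>j<n. E j) / real (Suc n) - 0) < e"
      by (simp add: pos_divide_less_eq mult.commute)
  qed
qed

text \<open>Unrolling \<open>rec\<close> writes \<open>W n x\<close> as
  \<open>W 0 ((T ^^ n) x)\<close> plus the terms \<open>a j ((T ^^ (n - 1 - j)) x)\<close> for
  \<open>j < n\<close>. Each \<open>j\<close> occurs once, so whatever points the orbit visits, the
  total is at most a constant plus the sum of the suprema of \<open>\<bar>a j\<bar>\<close>, and
  Cesaro averaging applies.\<close>

lemma uniform_limit_cocycle_average:
  fixes W a :: "nat \<Rightarrow> 'a \<Rightarrow> real"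
  assumes maps: "\<And>x. x \<in> X \<Longrightarrow> T x \<in> X"
    and rec: "\<And>n x. x \<in> X \<Longrightarrow> W (Suc n) x = a n x + W n (T x)"
    and lim: "uniform_limit X a (\<lambda>_. 0) sequentially"
    and bdd: "\<And>n. bounded (a n ` X)" and bdd0: "bounded (W 0 ` X)"
  shows "uniform_limit X (\<lambda>n x. W n x / real (Suc n)) (\<lambda>_. 0) sequentially"
proof (cases "X = {}")
  case False
  define E where "E n = (SUP x\<in>X. \<bar>a n x\<bar>)" for n
  have bdd_above: "bdd_above ((\<lambda>x. \<bar>a n x\<bar>) ` X)" for n
    using bounded_imp_bdd_above[OF bounded_norm_comp[THEN iffD2, OF bdd[of n]]] by simp
  have E: "\<bar>a n x\<bar> \<le> E n" if "x \<in> X" for n x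
    unfolding E_def using that bdd_above by (rule cSUP_upper)
  have "E \<longlonglongrightarrow> 0"
  proof (rule LIMSEQ_I)
    fix e :: real assume "e > 0"
    then obtain N where N: "\<And>n x. n \<ge> N \<Longrightarrow> x \<in> X \<Longrightarrow> \<bar>a n x\<bar> < e / 2"
      using lim unfolding uniform_limit_sequentially_iff
      by (metis dist_real_def diff_zero half_gt_zero)
    have "norm (E n - 0) < e" if "n \<ge> N" for n
    proof -
      have "E n \<le> e / 2"
        unfolding E_def using False N[OF that] by (intro cSUP_least) (auto intro: less_imp_le)
      moreover have "0 \<le> E n" using E False abs_ge_zero order_trans by blast
      ultimately show ?thesis using \<open>e > 0\<close> by simp
    qed
    then show "\<exists>no. \<forall>n\<ge>no. norm (E n - 0) < e" by blast
  qed
  obtain K where K: "\<And>x. x \<in> X \<Longrightarrow> \<bar>W 0 x\<bar> \<le> K"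
    using bdd0 by (auto simp: bounded_iff)
  have W: "\<bar>W n x\<bar> \<le> K + (\<Sum>j<n. E j)" if "x \<in> X" for n x
    using that
  proof (induction n arbitrary: x)
    case 0
    then show ?case using K by simp
  next
    case (Suc n)
    show ?case
      using rec[OF Suc.prems, of n] E[OF Suc.prems, of n] Suc.IH[OF maps[OF Suc.prems]] by simp
  qed
  have "(\<lambda>n. K / real (Suc n)) \<longlonglongrightarrow> 0"
    using LIMSEQ_inverse_real_of_nat[THEN tendsto_mult_left, of K] by (simp add: field_simps)
  from tendsto_add[OF this cesaro_mean_tendsto_zero[OF \<open>E \<longlonglongrightarrow> 0\<close>]]
  have "(\<lambda>n. (K + (\<Sum>j<n. E j)) / real (Suc n)) \<longlonglongrightarrow> 0"
    by (simp add: add_divide_distrib)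
  then have "uniform_limit X (\<lambda>n _. (K + (\<Sum>j<n. E j)) / real (Suc n)) (\<lambda>_. 0) sequentially"
    by (rule uniform_limit_of_tendsto)
  moreover have "\<forall>\<^sub>F n in sequentially. \<forall>x\<in>X.
      norm (W n x / real (Suc n)) \<le> (K + (\<Sum>j<n. E j)) / real (Suc n)"
    using W by (auto intro!: always_eventually divide_right_mono)
  ultimately show ?thesis
    by (rule uniform_limit_null_comparison[rotated])
qed simp

section \<open>Matrix products along sequences\<close>

lemma seq_shift_Omega: "\<omega> \<in> Omega b \<Longrightarrow> seq_shift \<omega> \<in> Omega b"
  by (simp add: Omega_def seq_shift_def)

lemma continuous_on_seq_shift: "continuous_on S seq_shift"
  unfolding seq_shift_def
  by (intro continuous_on_coordinatewise_then_product
        continuous_on_subset[OF continuous_on_product_coordinates]) simp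

lemma compact_Omega: "compact (Omega b)"
proof -
  have "compact_space (top_of_set (Omega b))"
    unfolding top_of_set_Omega
    by (simp add: compact_space_product_topology compact_space_discrete_topology)
  then show ?thesis
    by (simp add: compact_space_def compactin_subtopology)
qed

lemma norm_sum_nonneg: "norm_sum x \<ge> 0"
  by (simp add: norm_sum_def sum_nonneg)

lemma norm_sum_eq_0_iff: "norm_sum x = 0 \<longleftrightarrow> x = 0"
  by (simp add: norm_sum_def sum_nonneg_eq_0_iff vec_eq_iff)

lemma norm_sum_pos: "x \<noteq> 0 \<Longrightarrow> norm_sum x > 0"
  using norm_sum_nonneg[of x] norm_sum_eq_0_iff[of x] by linarith

lemma norm_sum_scaleR: "norm_sum (a *\<^sub>R x) = \<bar>a\<bar> * norm_sum x"
  by (simp add: norm_sum_def abs_mult sum_distrib_left)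

lemma continuous_on_norm_sum:
  "continuous_on S h \<Longrightarrow> continuous_on S (\<lambda>x. norm_sum (h x))"
  unfolding norm_sum_def by (intro continuous_intros)

lemma uniform_limit_norm_sum:
  assumes "uniform_limit X f l F"
  shows "uniform_limit X (\<lambda>n x. norm_sum (f n x)) (\<lambda>x. norm_sum (l x)) F"
proof -
  have "uniform_limit X (\<lambda>n x. \<Sum>j\<in>J. norm (f n x $ j)) (\<lambda>x. \<Sum>j\<in>J. norm (l x $ j)) F" for J
    by (induction J rule: infinite_finite_induct)
       (auto simp del: real_norm_def intro!: uniform_limit_add uniform_limit_norm uniform_limit_const
          bounded_linear.uniform_limit[OF bounded_linear_vec_nth assms])
  then show ?thesis by (simp add: norm_sum_def)
qed

text \<open>The recursion in the definition splits off the last letter; splitting off the first one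
  instead brings in the shift. Associativity carries the induction.\<close>

lemma mat_prod_Suc_left: "mat_prod M \<omega> (Suc n) = M (\<omega> 0) ** mat_prod M (seq_shift \<omega>) n"
proof (induction n)
  case (Suc n)
  have "mat_prod M \<omega> (Suc (Suc n)) = mat_prod M \<omega> (Suc n) ** M (\<omega> (Suc n))"
    by simp
  also have "\<dots> = M (\<omega> 0) ** mat_prod M (seq_shift \<omega>) (Suc n)"
    unfolding Suc.IH by (simp add: matrix_mul_assoc seq_shift_def)
  finally show ?case .
qed simp

text \<open>The alphabet is discrete, so \<open>M\<close> is automatically continuous, and so is its
  composition with the first coordinate.\<close>

lemma continuous_on_letter_mult:
  fixes M :: "nat \<Rightarrow> real^'d^'d"
  assumes "continuous_on S h"
  shows "continuous_on S (\<lambda>\<omega>. M (\<omega> 0) *v h \<omega>)"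
proof -
  have "continuous_on S (\<lambda>\<omega>. M (\<omega> 0))"
    using continuous_on_compose2[of UNIV M S "\<lambda>\<omega>. \<omega> 0"]
    by (auto intro: continuous_on_subset[OF continuous_on_product_coordinates])
  then show ?thesis
    unfolding matrix_vector_mult_def using assms
    by (intro continuous_on_vec_lambda continuous_on_sum continuous_on_mult continuous_on_component)
qed

lemma continuous_on_mat_prod_mult:
  "continuous_on UNIV (\<lambda>\<omega>. mat_prod M \<omega> n *v c)"
proof (induction n)
  case (Suc n)
  have "continuous_on UNIV (\<lambda>\<omega>. mat_prod M (seq_shift \<omega>) n *v c)"
    using continuous_on_compose2[OF Suc continuous_on_seq_shift] by simp
  then show ?case
    unfolding mat_prod_Suc_left matrix_vector_mul_assoc[symmetric]
    by (rule continuous_on_letter_mult)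
qed simp

lemma continuous_on_c_vec:
  assumes "\<And>\<omega>. \<omega> \<in> S \<Longrightarrow> mat_prod M \<omega> n *v c \<noteq> 0"
  shows "continuous_on S (\<lambda>\<omega>. c_vec M c \<omega> n)"
  unfolding c_vec_def using assms
  by (intro continuous_intros continuous_on_norm_sum
        continuous_on_subset[OF continuous_on_mat_prod_mult]) (auto simp: norm_sum_eq_0_iff)

lemma mat_prod_mult_eq_c_vec:
  assumes "mat_prod M \<omega> n *v c \<noteq> 0"
  shows "mat_prod M \<omega> n *v c = norm_sum (mat_prod M \<omega> n *v c) *\<^sub>R c_vec M c \<omega> n"
  using assms by (simp add: c_vec_def norm_sum_eq_0_iff)

text \<open>The shifted vector is its norm times \<open>c_vec\<close>, and this nonnegative scalar
  passes through both the matrix and \<open>norm_sum\<close>. Being an exact identity, it turns into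
  an additive recursion under \<open>ln\<close>.\<close>

lemma norm_sum_mat_prod_Suc:
  assumes "mat_prod M (seq_shift \<omega>) n *v c \<noteq> 0"
  shows "norm_sum (mat_prod M \<omega> (Suc n) *v c) =
    norm_sum (M (\<omega> 0) *v c_vec M c (seq_shift \<omega>) n) * norm_sum (mat_prod M (seq_shift \<omega>) n *v c)"
  unfolding mat_prod_Suc_left matrix_vector_mul_assoc[symmetric]
  by (subst mat_prod_mult_eq_c_vec[OF assms])
     (simp add: matrix_vector_mult_scaleR norm_sum_scaleR norm_sum_nonneg)

section \<open>The weak Gibbs property\<close>

theorem theoremA3:
  fixes b :: nat
    and r :: "nat \<Rightarrow> real^'d"
    and M :: "nat \<Rightarrow> real^'d^'d"
    and c :: "real^'d"
    and \<nu> :: "(nat \<Rightarrow> nat) measure"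
    and c_lim :: "(nat \<Rightarrow> nat) \<Rightarrow> real^'d"
  assumes "b \<ge> 1"
    and "\<And>i j. i < b \<Longrightarrow> r i $ j \<ge> 0"
    and "\<And>i j k. i < b \<Longrightarrow> M i $ j $ k \<ge> 0"
    and "\<And>j. c $ j > 0"
    and "(\<Sum>i<b. r i \<bullet> c) = 1"
    and "(\<Sum>i<b. M i *v c) = c"
    and "prob_space \<nu>"
    and "sets \<nu> = sets (restrict_space borel (Omega b))"
    and "\<And>\<omega> n. \<omega> \<in> Omega b \<Longrightarrow>
           measure \<nu> (cylinder b \<omega> (Suc n)) = r (\<omega> 0) \<bullet> (mat_prod M (seq_shift \<omega>) n *v c)"
    and "\<And>\<omega> n. \<omega> \<in> Omega b \<Longrightarrow> mat_prod M \<omega> n *v c \<noteq> 0"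
    and "uniform_limit (Omega b) (\<lambda>n \<omega>. c_vec M c \<omega> n) c_lim sequentially"
    and "\<And>i. i < b \<Longrightarrow>
           uniform_limit (Omega b) (\<lambda>n \<omega>. root n (r i \<bullet> c_vec M c \<omega> n)) (\<lambda>_. 1) sequentially"
    and "\<And>\<omega> i. \<omega> \<in> Omega b \<Longrightarrow> i < b \<Longrightarrow> M i *v c_lim \<omega> \<noteq> 0"
  shows "weak_Gibbs b \<nu>"
proof -
  let ?g = "\<lambda>n \<omega>. norm_sum (M (\<omega> 0) *v c_vec M c (seq_shift \<omega>) n)"
  let ?g' = "\<lambda>\<omega>. norm_sum (M (\<omega> 0) *v c_lim (seq_shift \<omega>))"
  let ?P = "\<lambda>n \<omega>. norm_sum (mat_prod M \<omega> n *v c)"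
  let ?\<rho> = "\<lambda>n \<omega>. r (\<omega> 0) \<bullet> c_vec M c (seq_shift \<omega>) n"
  define \<Phi> where "\<Phi> = (\<lambda>\<omega>. ln (?g' \<omega>))"
  note nz = assms(10) and shift = seq_shift_Omega[of _ b]
  have letter: "\<omega> 0 \<in> {..<b}" if "\<omega> \<in> Omega b" for \<omega>
    using that by (simp add: Omega_def)
  have P_pos: "?P n \<omega> > 0" if "\<omega> \<in> Omega b" for n \<omega>
    using nz[OF that] by (rule norm_sum_pos)
  have P_Suc: "?P (Suc n) \<omega> = ?g n \<omega> * ?P n (seq_shift \<omega>)" if "\<omega> \<in> Omega b" for n \<omega>
    using nz[OF shift[OF that]] by (rule norm_sum_mat_prod_Suc)
  \<comment> \<open>A zero factor would make \<open>?P (Suc n) \<omega>\<close> vanish.\<close>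
  have g_pos: "?g n \<omega> > 0" if "\<omega> \<in> Omega b" for n \<omega>
    using P_Suc[OF that, of n] P_pos[OF that, of "Suc n"] norm_sum_nonneg
    by (metis mult_zero_left order_less_le)

  have lim_g: "uniform_limit (Omega b) ?g ?g' sequentially"
  proof (rule uniform_limit_norm_sum, rule uniform_limit_finite_family
      [where I = "{..<b}" and A = "Omega b"
        and f = "\<lambda>i n \<omega>. M i *v c_vec M c \<omega> n" and l = "\<lambda>i \<omega>. M i *v c_lim \<omega>"])
    show "uniform_limit (Omega b) (\<lambda>n \<omega>. M i *v c_vec M c \<omega> n) (\<lambda>\<omega>. M i *v c_lim \<omega>) sequentially" for i
      by (rule bounded_linear.uniform_limit[OF matrix_vector_mul_bounded_linear assms(11)])
  qed (use letter shift in auto)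
  have cont_g: "continuous_on (Omega b) (?g n)" for n
    by (intro continuous_on_norm_sum continuous_on_letter_mult
          continuous_on_compose2[OF continuous_on_c_vec[where S = "Omega b"] continuous_on_seq_shift])
       (use nz shift in auto)
  have cont_g': "continuous_on (Omega b) ?g'"
    using uniform_limit_theorem[OF _ lim_g] cont_g by simp
  have g'_pos: "?g' \<omega> > 0" if "\<omega> \<in> Omega b" for \<omega>
    using assms(13)[OF shift[OF that], of "\<omega> 0"] letter[OF that] by (intro norm_sum_pos) simp
  have ne: "Omega b \<noteq> {}"
    using \<open>b \<ge> 1\<close> by (auto simp: Omega_def intro!: exI[of _ "\<lambda>_. 0"])
  \<comment> \<open>The minimum of \<open>?g'\<close> is the positive lower bound required for
    passing to logarithms uniformly.\<close>
  obtain \<omega>\<^sub>0 where "\<omega>\<^sub>0 \<in> Omega b" "\<And>\<omega>. \<omega> \<in> Omega b \<Longrightarrow> ?g' \<omega>\<^sub>0 \<le> ?g' \<omega>"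
    using continuous_attains_inf[OF compact_Omega ne cont_g'] by blast
  then have lim_ln: "uniform_limit (Omega b) (\<lambda>n \<omega>. ln (?g n \<omega>)) \<Phi> sequentially"
    unfolding \<Phi>_def using g'_pos by (intro uniform_limit_ln[OF lim_g, where \<delta> = "?g' \<omega>\<^sub>0"]) auto
  have cont_\<Phi>: "continuous_on (Omega b) \<Phi>"
    unfolding \<Phi>_def by (intro continuous_on_ln ballI less_imp_neq[THEN not_sym] cont_g' g'_pos)
  have cont_ln: "continuous_on (Omega b) (\<lambda>\<omega>. ln (?g n \<omega>))" for n
    by (intro continuous_on_ln ballI less_imp_neq[THEN not_sym] cont_g g_pos)

  define S where "S n \<omega> = (\<Sum>k<n. \<Phi> ((seq_shift ^^ k) \<omega>))" for n \<omega>
  have S_Suc: "S (Suc n) \<omega> = \<Phi> \<omega> + S n (seq_shift \<omega>)" for n \<omega>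
    unfolding S_def sum.lessThan_Suc_shift by (simp add: funpow_swap1 del: sum.lessThan_Suc)
  define W where "W n \<omega> = ln (?P n \<omega>) - S n \<omega>" for n \<omega>
  have lim_W: "uniform_limit (Omega b) (\<lambda>n \<omega>. W n \<omega> / real (Suc n)) (\<lambda>_. 0) sequentially"
  proof (rule uniform_limit_cocycle_average[where T = seq_shift and a = "\<lambda>n \<omega>. ln (?g n \<omega>) - \<Phi> \<omega>"])
    show "W (Suc n) \<omega> = ln (?g n \<omega>) - \<Phi> \<omega> + W n (seq_shift \<omega>)" if "\<omega> \<in> Omega b" for n \<omega>
      using g_pos[OF that, of n] P_pos[OF shift[OF that], of n]
      by (simp add: W_def P_Suc[OF that] S_Suc ln_mult del: mat_prod.simps)
    show "uniform_limit (Omega b) (\<lambda>n \<omega>. ln (?g n \<omega>) - \<Phi> \<omega>) (\<lambda>_. 0) sequentially"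
      using uniform_limit_minus[OF lim_ln uniform_limit_const[where c = \<Phi>]] by simp
    show "bounded ((\<lambda>\<omega>. ln (?g n \<omega>) - \<Phi> \<omega>) ` Omega b)" for n
      by (intro compact_imp_bounded compact_continuous_image compact_Omega continuous_on_diff
            cont_ln cont_\<Phi>)
    \<comment> \<open>The empty product is the identity and the empty sum is 0, so
      \<open>W 0\<close> is the constant \<open>ln (norm_sum c)\<close>.\<close>
    show "bounded (W 0 ` Omega b)"
      by (rule boundedI[of _ "\<bar>ln (norm_sum c)\<bar>"]) (auto simp: W_def S_def)
  qed (rule shift)
  \<comment> \<open>With a one-element index set the family lemma is just precomposition with the
    shift.\<close>
  have lim_W_shift: "uniform_limit (Omega b) (\<lambda>n \<omega>. W n (seq_shift \<omega>) / real (Suc n)) (\<lambda>_. 0) sequentially"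
    using uniform_limit_finite_family[where I = "{()}" and A = "Omega b" and B = "Omega b"
        and f = "\<lambda>_ n \<omega>. W n \<omega> / real (Suc n)" and l = "\<lambda>_ _. 0" and h = "\<lambda>_. ()" and k = seq_shift] lim_W shift by simp
  \<comment> \<open>The Birkhoff sum of length \<open>n + 1\<close> starts at
    \<open>\<omega>\<close>, whereas \<open>W n\<close> is taken at the shifted point; the
    difference is the single bounded term \<open>\<Phi> \<omega>\<close>.\<close>
  have lim_\<Phi>: "uniform_limit (Omega b) (\<lambda>n \<omega>. \<Phi> \<omega> / real (Suc n)) (\<lambda>_. 0) sequentially"
  proof -
    obtain K where "\<And>\<omega>. \<omega> \<in> Omega b \<Longrightarrow> \<bar>\<Phi> \<omega>\<bar> \<le> K"
      using compact_imp_bounded[OF compact_continuous_image[OF cont_\<Phi> compact_Omega]]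
      by (auto simp: bounded_iff)
    then have "\<forall>\<^sub>F n in sequentially. \<forall>\<omega>\<in>Omega b. norm (\<Phi> \<omega> / real (Suc n)) \<le> K / real (Suc n)"
      by (auto intro!: always_eventually divide_right_mono)
    moreover have "(\<lambda>n. K / real (Suc n)) \<longlonglongrightarrow> 0"
      using LIMSEQ_inverse_real_of_nat[THEN tendsto_mult_left, of K] by (simp add: field_simps)
    ultimately show ?thesis
      by (rule uniform_limit_null_comparison[OF _ uniform_limit_of_tendsto])
  qed
  have lim_root: "uniform_limit (Omega b) (\<lambda>n \<omega>. root n (?\<rho> n \<omega>)) (\<lambda>_. 1) sequentially"
    by (rule uniform_limit_finite_family[where I = "{..<b}" and A = "Omega b"
          and f = "\<lambda>i n \<omega>. root n (r i \<bullet> c_vec M c \<omega> n)" and l = "\<lambda>_ _. 1"]) (use letter shift assms(12) in auto)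
  \<comment> \<open>For \<open>n > 0\<close>, \<open>root n\<close> preserves signs, so a root
    within distance 1 of 1 forces a positive radicand. The case \<open>n = 0\<close> is excluded
    because \<open>root 0\<close> is 0 by convention.\<close>
  have \<rho>_pos: "\<forall>\<^sub>F n in sequentially. n > 0 \<and> (\<forall>\<omega>\<in>Omega b. ?\<rho> n \<omega> > 0)"
    using uniform_limitD[OF lim_root zero_less_one] eventually_gt_at_top[of "0::nat"]
  proof eventually_elim
    case (elim n)
    have "root n (?\<rho> n \<omega>) > 0" if "\<omega> \<in> Omega b" for \<omega>
      using bspec[OF elim(1) that] unfolding dist_real_def by linarith
    then show ?case using elim by simp
  qed
  have lim_\<rho>: "uniform_limit (Omega b) (\<lambda>n \<omega>. ln (?\<rho> n \<omega>) / real (Suc n)) (\<lambda>_. 0) sequentially"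
  proof (rule uniform_limit_null_comparison)
    show "uniform_limit (Omega b) (\<lambda>n \<omega>. \<bar>ln (root n (?\<rho> n \<omega>))\<bar>) (\<lambda>_. 0) sequentially"
      using uniform_limit_norm[OF uniform_limit_ln[OF lim_root zero_less_one]] by simp
    \<comment> \<open>The hypothesis concerns \<open>n\<close>-th roots, but the cylinder has length
      \<open>n + 1\<close>; the larger denominator only decreases the absolute value.\<close>
    show "\<forall>\<^sub>F n in sequentially. \<forall>\<omega>\<in>Omega b.
        norm (ln (?\<rho> n \<omega>) / real (Suc n)) \<le> \<bar>ln (root n (?\<rho> n \<omega>))\<bar>"
      using \<rho>_pos by eventually_elim (auto simp: ln_root intro!: divide_left_mono)
  qed
  have lim_exponent: "uniform_limit (Omega b)
      (\<lambda>n \<omega>. (ln (?\<rho> n \<omega>) + W n (seq_shift \<omega>) - \<Phi> \<omega>) / real (Suc n)) (\<lambda>_. 0) sequentially"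
    (is "uniform_limit _ ?t _ _")
    using uniform_limit_minus[OF uniform_limit_add[OF lim_\<rho> lim_W_shift] lim_\<Phi>]
    by (simp add: add_divide_distrib diff_divide_distrib)

  have root_eq: "root (Suc n) (measure \<nu> (cylinder b \<omega> (Suc n)) / exp (S (Suc n) \<omega>)) = exp (?t n \<omega>)"
    if "\<omega> \<in> Omega b" and pos: "?\<rho> n \<omega> > 0" for n \<omega>
  proof -
    let ?x = "measure \<nu> (cylinder b \<omega> (Suc n)) / exp (S (Suc n) \<omega>)"
    \<comment> \<open>The first letter selects the row vector, so only \<open>n\<close> matrices
      enter the measure of a cylinder of length \<open>n + 1\<close>.\<close>
    have "r (\<omega> 0) \<bullet> (mat_prod M (seq_shift \<omega>) n *v c) = ?P n (seq_shift \<omega>) * ?\<rho> n \<omega>"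
      by (subst mat_prod_mult_eq_c_vec[OF nz[OF shift[OF that(1)]]]) simp
    then have x: "?x = ?P n (seq_shift \<omega>) * ?\<rho> n \<omega> / exp (S (Suc n) \<omega>)"
      by (simp add: assms(9)[OF that(1)])
    have "?x > 0"
      unfolding x using pos P_pos[OF shift[OF that(1)], of n] by simp
    moreover have "ln ?x = ln (?\<rho> n \<omega>) + W n (seq_shift \<omega>) - \<Phi> \<omega>"
      unfolding x using pos P_pos[OF shift[OF that(1)], of n]
      by (simp add: ln_div ln_mult W_def S_Suc)
    ultimately have "ln (root (Suc n) ?x) = ?t n \<omega>" "root (Suc n) ?x > 0"
      by (simp_all add: ln_root)
    then show ?thesis by (metis exp_ln)
  qed
  have "uniform_limit (Omega b)
      (\<lambda>n \<omega>. root n (measure \<nu> (cylinder b \<omega> n) / exp (S n \<omega>))) (\<lambda>_. 1) sequentially"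
  proof (rule uniform_limitI)
    fix e :: real assume "e > 0"
    obtain d where "d > 0" and d: "\<And>t. \<bar>t\<bar> < d \<Longrightarrow> dist (exp t) (1::real) < e"
      using isCont_exp[of "0::real"] \<open>e > 0\<close> unfolding continuous_at_eps_delta
      by (auto simp: dist_real_def)
    have "\<forall>\<^sub>F n in sequentially. \<forall>\<omega>\<in>Omega b.
        dist (root (Suc n) (measure \<nu> (cylinder b \<omega> (Suc n)) / exp (S (Suc n) \<omega>))) 1 < e"
      using uniform_limitD[OF lim_exponent \<open>d > 0\<close>] \<rho>_pos
      by eventually_elim (auto simp: root_eq dist_real_def[of _ 0] intro!: d)
    then show "\<forall>\<^sub>F n in sequentially. \<forall>\<omega>\<in>Omega b.
        dist (root n (measure \<nu> (cylinder b \<omega> n) / exp (S n \<omega>))) 1 < e"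
      \<comment> \<open>Reindexing from \<open>n + 1\<close> to \<open>n\<close> leaves out only
        length 0, which does not affect an eventual statement.\<close>
      by (subst (asm) eventually_sequentially_Suc)
  qed
  with cont_\<Phi> show ?thesis
    unfolding weak_Gibbs_def S_def by blast
qed

end
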